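(* Let $\Theta=(\theta_1,\dots,\theta_n)$ be a $\mathbf{\Theta}_n$-inner function. Then $(\theta_1,\dots,\theta_{n-1},\theta_n^p)$ is a $\Gamma_n$-inner function.
   Context: $\mathbb D$ is the open unit disc, $\mathbb T$ the unit circle. Fix positive integers $m,p$ with $p$ dividing $m$, and $n\ge2$. Let $s_i$ be the $i$-th elementary symmetric polynomial in $n$ variables and $\mathbf s=(s_1,\dots,s_n)$. Define $\theta:\mathbb C^n\to\mathbb C^n$ by $\theta(z)=\big(s_1(z_1^m,\dots,z_n^m),\dots,s_{n-1}(z_1^m,\dots,z_n^m),(z_1\cdots z_n)^{m/p}\big)$, and set $\mathbf{\Theta}_n=\theta(\mathbb D^n)$, $\overline{\mathbf{\Theta}}_n=\theta(\overline{\mathbb D}^n)$, $\Gamma_n=\mathbf s(\overline{\mathbb D}^n)$. The distinguished boundaries $b\mathbf{\Theta}_n$ and $b\Gamma_n$ are the Shilov boundaries of $\overline{\mathbf{\Theta}}_n$ and $\Gamma_n$, i.e. the smallest closed subsets on which every function continuous on the compact set and holomorphic in its interior attains its maximum modulus (known to equal $\theta(\mathbb T^n)$ and $\mathbf s(\mathbb T^n)$). A $\mathbf{\Theta}_n$-inner (respectively $\Gamma_n$-inner) function is a holomorphic map $\mathbb D\to\overline{\mathbf{\Theta}}_n$ (respectively $\mathbb D\to\Gamma_n$) whose radial limits belong to $b\mathbf{\Theta}_n$ (respectively $b\Gamma_n$) at Lebesgue-a.e. point of $\mathbb T$. Here $\theta_n^p(z)=(\theta_n(z))^p$. *)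

theory Defs
  imports "HOL-Complex_Analysis.Complex_Analysis"
begin

text \<open>
  The coordinates of \<^typ>\<open>complex ^ 'n\<close> are ordered by the linear order on \<^typ>\<open>'n\<close>;
  \<open>pos i \<in> {1..CARD('n)}\<close> is the number of the coordinate \<open>i\<close> in that order.
\<close>

definition pos :: "'n::{finite, linorder} \<Rightarrow> nat" where
  "pos i = card {j. j \<le> i}"

definition elem_sym :: "nat \<Rightarrow> complex ^ 'n \<Rightarrow> complex" where
  "elem_sym k z = (\<Sum>S | card S = k. \<Prod>j\<in>S. z $ j)"

definition sym_map :: "complex ^ 'n::{finite, linorder} \<Rightarrow> complex ^ 'n::{finite, linorder}" where
  "sym_map z = (\<chi> i. elem_sym (pos i) z)"

definition theta :: "nat \<Rightarrow> nat \<Rightarrow> complex ^ 'n::{finite, linorder} \<Rightarrow> complex ^ 'n::{finite, linorder}" where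
  "theta m p z =
    (\<chi> i. if pos i < CARD('n) then elem_sym (pos i) (\<chi> j. (z $ j) ^ m)
         else (\<Prod>j\<in>UNIV. z $ j) ^ (m div p))"

definition closed_polydisc :: "(complex ^ 'n) set" where
  "closed_polydisc = {z. \<forall>i. z $ i \<in> cball 0 1}"

definition Theta_closed :: "nat \<Rightarrow> nat \<Rightarrow> (complex ^ 'n::{finite, linorder}) set" where
  "Theta_closed m p = theta m p ` closed_polydisc"

definition Gamma_closed :: "(complex ^ 'n::{finite, linorder}) set" where
  "Gamma_closed = sym_map ` closed_polydisc"

text \<open>Holomorphy in several variables: a complex-linear Frechet derivative at every point.\<close>

definition mholomorphic_on :: "(complex ^ 'n \<Rightarrow> complex) \<Rightarrow> (complex ^ 'n) set \<Rightarrow> bool" where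
  "mholomorphic_on f U \<longleftrightarrow>
    (\<forall>z\<in>U. \<exists>f'. (f has_derivative f') (at z) \<and> (\<forall>c h. f' (c *s h) = c * f' h))"

definition hol_algebra :: "(complex ^ 'n) set \<Rightarrow> (complex ^ 'n \<Rightarrow> complex) set" where
  "hol_algebra K = {f. continuous_on K f \<and> mholomorphic_on f (interior K)}"

definition closed_boundary :: "(complex ^ 'n) set \<Rightarrow> (complex ^ 'n) set \<Rightarrow> bool" where
  "closed_boundary K B \<longleftrightarrow> closed B \<and> B \<subseteq> K \<and>
    (\<forall>f\<in>hol_algebra K. \<exists>b\<in>B. \<forall>z\<in>K. norm (f z) \<le> norm (f b))"

definition shilov_boundary :: "(complex ^ 'n) set \<Rightarrow> (complex ^ 'n) set" where
  "shilov_boundary K = (LEAST B. closed_boundary K B)"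

text \<open>
  The exceptional null set on the unit circle is measured through \<open>t \<mapsto> exp (i t)\<close> on
  \<open>[0, 2 pi]\<close>. The radial limit is required to exist almost everywhere, which by Fatou's theorem
  is automatic when \<open>K\<close> is bounded.
\<close>

definition inner_function :: "(complex ^ 'n) set \<Rightarrow> (complex \<Rightarrow> complex ^ 'n) \<Rightarrow> bool" where
  "inner_function K f \<longleftrightarrow>
    (\<forall>i. (\<lambda>z. f z $ i) holomorphic_on ball 0 1) \<and> f ` ball 0 1 \<subseteq> K \<and>
    (AE t in lebesgue_on {0..2 * pi}.
      \<exists>l\<in>shilov_boundary K. ((\<lambda>r. f (of_real r * cis t)) \<longlongrightarrow> l) (at_left 1))"

definition Theta_inner :: "nat \<Rightarrow> nat \<Rightarrow> (complex \<Rightarrow> complex ^ 'n::{finite, linorder}) \<Rightarrow> bool" where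
  "Theta_inner m p = inner_function (Theta_closed m p)"

definition Gamma_inner :: "(complex \<Rightarrow> complex ^ 'n::{finite, linorder}) \<Rightarrow> bool" where
  "Gamma_inner = inner_function Gamma_closed"

end

theory Submission
  imports Defs "HOL-Computational_Algebra.Fundamental_Theorem_Algebra"
begin

text \<open>
  Raising the last coordinate to the power \<open>p\<close> is a continuous map, called \<open>power_last p\<close> below, that
  turns \<open>\<theta>(z)\<close> into \<open>s(z\<^sub>1\<^sup>m, \<dots>, z\<^sub>n\<^sup>m)\<close>. Since \<open>u \<mapsto> u\<^sup>m\<close> maps the closed disc into itself and the unit
  circle into itself, \<open>power_last p\<close> carries \<open>\<theta>\<close> of the closed polydisc into \<open>\<Gamma>\<^sub>n\<close> and \<open>\<theta>\<close> of the torus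
  into \<open>s\<close> of the torus. Radial limits pass through a continuous map, so the proposition follows
  as soon as the Shilov boundaries are known to be the images of the torus. The map \<open>s\<close> is
  \<open>\<theta>\<close> with \<open>m = p = 1\<close>, so one computation (\<open>shilov_boundary_Theta_closed\<close>) covers both domains.

  The image of the torus is a boundary (\<open>closed_boundary_theta_torus\<close>). Through every point \<open>z\<close> of
  the open polydisc passes the analytic disc whose \<open>i\<close>-th coordinate is the disc automorphism
  taking \<open>0\<close> to \<open>z\<^sub>i\<close>; its rim lies in the torus, and the maximum modulus principle in one
  variable bounds \<open>f(\<theta>(z))\<close>. For this, \<open>f \<circ> \<theta>\<close> has to be holomorphic along the disc, that is,
  \<open>\<theta>\<close> has to map the open polydisc into the interior of the compact set
  (\<open>theta_open_polydisc_interior\<close>). The reason is that "all roots \<open>z\<^sub>k\<^sup>m\<close> lie in the open disc" is an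
  open condition on the coefficients, and that \<open>\<theta>\<close> is surjective by the fundamental theorem of
  algebra (\<open>theta_surj\<close>).

  Every closed boundary contains the image of the torus (\<open>theta_torus_subset_closed_boundary\<close>). By
  density it suffices to treat points \<open>\<zeta>\<close> whose coordinates are \<open>N\<close>-th roots of unity. The function
  \<open>\<Prod>\<^sub>k (1 + (z\<^sub>k\<^sup>m)\<^sup>N) / 2\<close> is a polynomial in the coordinates of \<open>\<theta>(z)\<close>, because \<open>1 + x\<^sup>N\<close> is a product
  of linear factors and \<open>\<Prod>\<^sub>k (a + b z\<^sub>k\<^sup>m)\<close> is an explicit combination of elementary symmetric
  functions. It has modulus at most \<open>1\<close>, with equality at finitely many points of the compact set,
  \<open>\<theta>(\<zeta>)\<close> among them. High powers of it, times a polynomial that vanishes at the other maximum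
  points, are larger at \<open>\<theta>(\<zeta>)\<close> than on any closed subset that avoids \<open>\<theta>(\<zeta>)\<close>
  (\<open>peak_point_in_closed_boundary\<close>).
\<close>

no_notation fps_nth (infixl "$" 75)

section \<open>The coordinates as coefficients of a binary form\<close>

definition torus :: "(complex ^ 'n) set" where
  "torus = {z. \<forall>i. norm (z $ i) = 1}"

definition power_last :: "nat \<Rightarrow> complex ^ 'n::{finite, linorder} \<Rightarrow> complex ^ 'n::{finite, linorder}" where
  "power_last p w = (\<chi> i. if pos i < CARD('n) then w $ i else (w $ i) ^ p)"

text \<open>
  A point is read as the list of values \<open>e\<^sub>1, \<dots>, e\<^sub>n\<close> of the elementary symmetric polynomials;
  index \<open>0\<close> is added for \<open>e\<^sub>0 = 1\<close>.
\<close>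

definition esym_coeff :: "nat \<Rightarrow> complex ^ 'n::{finite, linorder} \<Rightarrow> complex" where
  "esym_coeff j w = (if j = 0 then 1 else w $ inv_into UNIV pos j)"

text \<open>
  The polynomial whose roots are the variables behind the symmetric functions, in homogeneous
  form: at \<open>(a, b) = (X, -1)\<close> it is the monic polynomial in \<open>X\<close> with these roots, and at
  \<open>(a, b) = (1, y)\<close> the reciprocal one, with the zeros \<open>- 1 / x\<close> for the
  nonzero roots \<open>x\<close>, whose value at \<open>y = 0\<close> is \<open>1\<close>.
\<close>

definition char_form :: "complex \<Rightarrow> complex \<Rightarrow> complex ^ 'n::{finite, linorder} \<Rightarrow> complex" where
  "char_form a b w = (\<Sum>j\<le>CARD('n). a ^ (CARD('n) - j) * b ^ j * esym_coeff j w)"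

lemma pos_bij: "bij_betw (pos :: 'n::{finite, linorder} \<Rightarrow> nat) UNIV {1..CARD('n)}"
proof -
  have "strict_mono (pos :: 'n \<Rightarrow> nat)"
    unfolding strict_mono_def pos_def
    by (intro allI impI psubset_card_mono psubsetI) (auto simp: set_eq_iff not_le[symmetric])
  then have inj: "inj (pos :: 'n \<Rightarrow> nat)"
    by (rule strict_mono_imp_inj_on)
  have sub: "range (pos :: 'n \<Rightarrow> nat) \<subseteq> {1..CARD('n)}"
  proof
    fix k assume "k \<in> range (pos :: 'n \<Rightarrow> nat)"
    then obtain i :: 'n where k: "k = card {j. j \<le> i}"
      by (auto simp: pos_def)
    have "i \<in> {j. j \<le> i}" by simp
    then have "card {j. j \<le> i} > 0"
      by (metis card_gt_0_iff empty_iff finite)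
    then show "k \<in> {1..CARD('n)}"
      using card_mono[of "UNIV :: 'n set" "{j. j \<le> i}"] by (simp add: k)
  qed
  have "card (range (pos :: 'n \<Rightarrow> nat)) = card {1..CARD('n)}"
    using inj by (simp add: card_image)
  then have "range (pos :: 'n \<Rightarrow> nat) = {1..CARD('n)}"
    using sub by (intro card_subset_eq) auto
  then show ?thesis
    using inj by (simp add: bij_betw_def)
qed

lemma pos_inv:
  assumes "j \<in> {1..CARD('n)}"
  shows "pos (inv_into UNIV pos j :: 'n::{finite, linorder}) = j"
  using pos_bij[where 'n='n] assms
  by (metis bij_betw_inv_into_right)

lemma inv_pos [simp]: "inv_into UNIV pos (pos i) = (i :: 'n::{finite, linorder})"
  using pos_bij[where 'n='n] by (simp add: bij_betw_def)

lemma pos_bounds: "1 \<le> pos i" "pos (i :: 'n::{finite, linorder}) \<le> CARD('n)"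
  using bij_betwE[OF pos_bij[where 'n='n]] by auto

lemma esym_coeff_pos [simp]: "esym_coeff (pos i) w = w $ i"
  using pos_bounds(1)[of i] by (auto simp: esym_coeff_def)

lemma elem_sym_0 [simp]: "elem_sym 0 z = 1"
proof -
  have "{S :: 'a set. card S = 0} = {{}}" by auto
  then show ?thesis unfolding elem_sym_def by (simp only:) simp
qed

lemma elem_sym_card: "elem_sym CARD('n) (z :: complex ^ 'n) = (\<Prod>j\<in>UNIV. z $ j)"
proof -
  have "{S :: 'n set. card S = CARD('n)} = {UNIV}"
    by (auto dest: card_eq_UNIV_imp_eq_UNIV[OF finite])
  then show ?thesis unfolding elem_sym_def by (simp only:) simp
qed

lemma esym_coeff_sym_map:
  "j \<le> CARD('n) \<Longrightarrow> esym_coeff j (sym_map (x :: complex ^ 'n::{finite, linorder})) = elem_sym j x"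
  using pos_inv[of j, where 'n='n] by (auto simp: esym_coeff_def sym_map_def)

text \<open>Vieta\<close>

text \<open>
  Vieta's formula: expand the product over the subsets \<open>S\<close> of factors that contribute their
  second summand and collect the subsets by size.
\<close>

lemma char_form_sym_map:
  fixes x :: "complex ^ 'n::{finite, linorder}"
  shows "char_form a b (sym_map x) = (\<Prod>k\<in>UNIV. a + b * x $ k)"
proof -
  have "(\<Prod>k\<in>UNIV. a + b * x $ k) = (\<Prod>k\<in>UNIV. b * x $ k + a)"
    by (simp add: add.commute)
  also have "\<dots> = (\<Sum>S\<in>Pow UNIV. (\<Prod>k\<in>S. b * x $ k) * (\<Prod>k\<in>UNIV - S. a))"
    by (rule prod_add) simp
  also have "\<dots> = (\<Sum>S\<in>Pow UNIV. a ^ (CARD('n) - card S) * b ^ card S * (\<Prod>k\<in>S. x $ k))"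
    by (intro sum.cong) (auto simp: prod.distrib card_Diff_subset)
  also have "\<dots> = (\<Sum>j\<le>CARD('n). \<Sum>S\<in>{S \<in> Pow UNIV. card S = j}.
      a ^ (CARD('n) - card S) * b ^ card S * (\<Prod>k\<in>S. x $ k))"
    by (rule sum.group[symmetric]) (auto intro: card_mono)
  also have "\<dots> = (\<Sum>j\<le>CARD('n). a ^ (CARD('n) - j) * b ^ j * elem_sym j x)"
    by (intro sum.cong) (auto simp: elem_sym_def sum_distrib_left)
  also have "\<dots> = char_form a b (sym_map x)"
    unfolding char_form_def by (intro sum.cong) (simp_all add: esym_coeff_sym_map)
  finally show ?thesis by simp
qed

lemma char_form_reversed:
  fixes w :: "complex ^ 'n::{finite, linorder}"
  shows "char_form a b w
    = (\<Sum>i\<le>CARD('n). (b ^ (CARD('n) - i) * esym_coeff (CARD('n) - i) w) * a ^ i)"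
  unfolding char_form_def
  by (rule sum.reindex_bij_witness[of _ "\<lambda>i. CARD('n) - i" "\<lambda>i. CARD('n) - i"])
     (auto simp: mult_ac)

lemma char_form_monic_inject:
  fixes v w :: "complex ^ 'n::{finite, linorder}"
  assumes "\<And>a. char_form a (-1) v = char_form a (-1) w"
  shows "v = w"
proof -
  have "\<forall>i\<le>CARD('n). (-1) ^ (CARD('n) - i) * esym_coeff (CARD('n) - i) v
      = (-1) ^ (CARD('n) - i) * esym_coeff (CARD('n) - i) w"
    using assms unfolding char_form_reversed by (subst polyfun_eq_coeffs[symmetric]) blast
  then have *: "esym_coeff (CARD('n) - i) v = esym_coeff (CARD('n) - i) w" if "i \<le> CARD('n)" for i
    using that by simp
  show ?thesis
  proof (rule vec_eq_iff[THEN iffD2], rule allI)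
    fix i :: 'n
    show "v $ i = w $ i"
      using *[of "CARD('n) - pos i"] pos_bounds[of i] by simp
  qed
qed

text \<open>
  The coordinates of \<open>w\<close> are, up to sign, the coefficients of a monic polynomial of degree \<open>n\<close>,
  which splits over the complex numbers; its roots, in any order, form a preimage.
\<close>

lemma sym_map_surj: "\<exists>x. sym_map x = (w :: complex ^ 'n::{finite, linorder})"
proof -
  define n where "n = CARD('n)"
  define c where "c i = (-1) ^ (n - i) * esym_coeff (n - i) w" for i
  define P where "P = (\<Sum>i\<le>n. monom (c i) i)"
  have coeff: "coeff P i = (if i \<le> n then c i else 0)" for i
    by (auto simp: P_def coeff_sum)
  have "c n = 1" by (simp add: c_def esym_coeff_def)
  then have deg: "degree P = n"
    using coeff by (intro antisym degree_le le_degree) auto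
  then have lead: "lead_coeff P = 1" using coeff \<open>c n = 1\<close> by simp
  have poly_P: "poly P a = char_form a (-1) w" for a
    by (simp add: P_def poly_sum poly_monom char_form_reversed c_def n_def)
  obtain root where root: "smult (lead_coeff P) (\<Prod>i<degree P. [:-root i, 1:]) = P"
    using complex_poly_decompose'[of P] .
  obtain h :: "'n \<Rightarrow> nat" where h: "bij_betw h UNIV {..<n}"
    using finite_same_card_bij[of "UNIV :: 'n set" "{..<n}", OF finite finite_lessThan]
    unfolding n_def card_lessThan by blast
  define x :: "complex ^ 'n::{finite, linorder}" where "x = (\<chi> k. root (h k))"
  have "char_form a (-1) (sym_map x) = char_form a (-1) w" for a
  proof -
    have "char_form a (-1) (sym_map x) = (\<Prod>k\<in>UNIV. a - root (h k))"
      by (simp add: char_form_sym_map x_def)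
    also have "\<dots> = (\<Prod>i<n. a - root i)"
      by (rule prod.reindex_bij_betw[OF h])
    also have "\<dots> = poly P a"
      by (subst root[symmetric]) (simp only: lead, simp add: deg poly_prod)
    finally show ?thesis by (simp add: poly_P)
  qed
  then show ?thesis by (blast intro: char_form_monic_inject)
qed

text \<open>
  This identity links the two domains. In the last coordinate it holds because the exponents
  \<open>m div p\<close> and \<open>p\<close> multiply to \<open>m\<close>.
\<close>

lemma power_last_theta:
  assumes "p dvd m"
  shows "power_last p (theta m p z) = sym_map (\<chi> k. (z $ k) ^ m)"
proof (rule vec_eq_iff[THEN iffD2], rule allI)
  fix i :: 'a
  show "power_last p (theta m p z) $ i = sym_map (\<chi> k. (z $ k) ^ m) $ i"
  proof (cases "pos i < CARD('a)")
    case True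
    then show ?thesis by (simp add: power_last_def theta_def sym_map_def)
  next
    case False
    then have "pos i = CARD('a)" using pos_bounds(2)[of i] by simp
    then show ?thesis using assms
      by (simp add: power_last_def theta_def sym_map_def elem_sym_card
          power_mult[symmetric] prod_power_distrib)
  qed
qed

lemma char_form_theta:
  fixes z :: "complex ^ 'n::{finite, linorder}"
  assumes "p dvd m"
  shows "char_form a b (power_last p (theta m p z)) = (\<Prod>k\<in>UNIV. a + b * (z $ k) ^ m)"
  by (simp add: power_last_theta[OF assms] char_form_sym_map)

text \<open>
  Taking \<open>m\<close>-th roots of a preimage under \<^const>\<open>sym_map\<close> gives the right first \<open>n - 1\<close> coordinates,
  and a last coordinate with the right \<open>p\<close>-th power. The remaining \<open>p\<close>-th root of unity is
  corrected by multiplying one variable by an \<open>m\<close>-th root of unity, which does not affect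
  the \<open>m\<close>-th powers.
\<close>

lemma theta_surj:
  fixes w :: "complex ^ 'n::{finite, linorder}"
  assumes "m > 0" "p dvd m"
  shows "\<exists>z. theta m p z = w"
proof -
  have "p > 0" using assms by (auto intro: Nat.gr0I)
  obtain x where x: "sym_map x = power_last p w" using sym_map_surj by blast
  have "\<exists>y. \<forall>k. x $ k = y k ^ m"
  proof (rule choice, rule allI)
    fix k
    from assms(1) have "m \<noteq> 0" by simp
    then obtain u where "x $ k = u ^ m" by (rule exists_complex_root)
    then show "\<exists>u. x $ k = u ^ m" by (rule exI)
  qed
  then obtain y where y: "\<And>k. x $ k = y k ^ m" by blast
  define l :: 'n where "l = inv_into UNIV pos CARD('n)"
  have pos_l: "pos l = CARD('n)"
    unfolding l_def by (rule pos_inv) simp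
  define t where "t = (\<Prod>k\<in>UNIV. y k) ^ (m div p)"
  have tp: "t ^ p = (w $ l) ^ p"
  proof -
    have "t ^ p = (\<Prod>k\<in>UNIV. x $ k)"
      using assms by (simp add: t_def y power_mult[symmetric] prod_power_distrib)
    also have "\<dots> = sym_map x $ l"
      by (simp add: sym_map_def pos_l elem_sym_card)
    finally show ?thesis by (simp add: x power_last_def pos_l)
  qed
  \<comment> \<open>An \<open>(m div p)\<close>-th root of the \<open>p\<close>-th root of unity \<open>w $ l / t\<close> is an \<open>m\<close>-th root of unity.\<close>
  obtain \<eta> where \<eta>: "\<eta> ^ m = 1" "\<eta> ^ (m div p) * t = w $ l"
  proof (cases "t = 0")
    case True
    then have "w $ l = 0" using tp \<open>p > 0\<close> by (metis power_eq_0_iff)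
    then show ?thesis using True by (intro that[of 1]) simp_all
  next
    case False
    have "m div p \<noteq> 0" using assms by (metis dvd_div_eq_0_iff less_irrefl)
    then obtain \<eta> where *: "w $ l / t = \<eta> ^ (m div p)" by (rule exists_complex_root)
    have "\<eta> ^ m = (w $ l / t) ^ p"
      unfolding * power_mult[symmetric] using assms by simp
    also have "\<dots> = 1" unfolding power_divide tp[symmetric] using False by simp
    finally have "\<eta> ^ m = 1" .
    moreover have "\<eta> ^ (m div p) * t = w $ l"
      using * nonzero_divide_eq_eq[OF False] by metis
    ultimately show ?thesis by (rule that)
  qed
  define z :: "complex ^ 'n::{finite, linorder}" where "z = (\<chi> k. if k = l then \<eta> * y k else y k)"
  have zm: "(\<chi> k. (z $ k) ^ m) = x"
    by (simp add: vec_eq_iff z_def y power_mult_distrib \<eta>(1))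
  have "(\<Prod>k\<in>UNIV. z $ k) = (\<Prod>k\<in>UNIV. (if k = l then \<eta> else 1) * y k)"
    by (intro prod.cong) (auto simp: z_def)
  also have "\<dots> = \<eta> * (\<Prod>k\<in>UNIV. y k)"
    by (simp add: prod.distrib)
  finally have zprod: "(\<Prod>k\<in>UNIV. z $ k) ^ (m div p) = w $ l"
    using \<eta>(2) by (simp add: power_mult_distrib t_def)
  have "theta m p z $ i = w $ i" for i
  proof (cases "pos i < CARD('n)")
    case True
    then have "theta m p z $ i = sym_map x $ i"
      by (simp add: theta_def sym_map_def zm)
    then show ?thesis using True by (simp add: x power_last_def)
  next
    case False
    then have "pos i = CARD('n)" using pos_bounds(2)[of i] by simp
    then have "i = l" by (metis inv_pos l_def)
    then show ?thesis using pos_l by (simp add: theta_def zprod)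
  qed
  then have "theta m p z = w" by (simp add: vec_eq_iff)
  then show ?thesis by (rule exI)
qed

section \<open>The image of the open polydisc lies in the interior\<close>

lemma continuous_on_theta: "continuous_on S (theta m p)"
proof (unfold theta_def elem_sym_def, intro continuous_on_vec_lambda)
  show "continuous_on S (\<lambda>z. if pos i < CARD('a) then \<Sum>S | card S = pos i. \<Prod>j\<in>S. (\<chi> j. (z $ j) ^ m) $ j
      else (\<Prod>j\<in>UNIV. z $ j) ^ (m div p))" for i :: 'a
    by (cases "pos i < CARD('a)") (auto intro!: continuous_intros)
qed

lemma continuous_on_power_last: "continuous_on S (power_last p)"
proof (unfold power_last_def, intro continuous_on_vec_lambda)
  show "continuous_on S (\<lambda>z. if pos i < CARD('a) then z $ i else (z $ i) ^ p)" for i :: 'a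
    by (cases "pos i < CARD('a)") (auto intro!: continuous_intros)
qed

lemma continuous_on_esym_coeff [continuous_intros]:
  "continuous_on S f \<Longrightarrow> continuous_on S (\<lambda>x. esym_coeff j (f x))"
  unfolding esym_coeff_def by (cases "j = 0") (auto intro!: continuous_intros)

lemma compact_closed_polydisc: "compact (closed_polydisc :: (complex ^ 'n) set)"
proof -
  have "closed_polydisc \<subseteq> cball (0 :: complex ^ 'n) (real CARD('n))"
  proof
    fix z :: "complex ^ 'n" assume "z \<in> closed_polydisc"
    then have "(\<Sum>i\<in>UNIV. norm (z $ i)) \<le> (\<Sum>i\<in>(UNIV :: 'n set). 1)"
      by (intro sum_mono) (auto simp: closed_polydisc_def)
    then show "z \<in> cball 0 (real CARD('n))"
      using L2_set_le_sum[of UNIV "\<lambda>i. norm (z $ i)"] by (simp add: norm_vec_def)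
  qed
  then have "bounded (closed_polydisc :: (complex ^ 'n) set)"
    using bounded_cball bounded_subset by blast
  moreover have "closed (closed_polydisc :: (complex ^ 'n) set)"
    unfolding closed_polydisc_def mem_cball dist_0_norm
    by (intro closed_Collect_all closed_Collect_le continuous_intros)
  ultimately show ?thesis by (simp add: compact_eq_bounded_closed)
qed

lemma torus_subset: "torus \<subseteq> closed_polydisc"
  by (auto simp: torus_def closed_polydisc_def)

lemma compact_torus: "compact (torus :: (complex ^ 'n) set)"
proof -
  have "closed (torus :: (complex ^ 'n) set)"
    unfolding torus_def by (intro closed_Collect_all closed_Collect_eq continuous_intros)
  then show ?thesis
    using compact_Int_closed[OF compact_closed_polydisc] torus_subset
    by (metis Int_absorb1)
qed

lemma compact_Theta_closed: "compact (Theta_closed m p)"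
  unfolding Theta_closed_def
  by (intro compact_continuous_image continuous_on_theta compact_closed_polydisc)

text \<open>
  The set \<open>U\<close> of the coefficient vectors for which the reciprocal polynomial has no zero in the closed
  unit disc is open, because its complement is the projection of a closed set along a compact
  disc. Working with the reciprocal polynomial is what makes the parameter range compact: its
  zeros in the closed disc are the numbers \<open>- 1 / x\<close> for the roots \<open>x\<close> outside the open disc.
\<close>

lemma theta_open_polydisc_interior:
  fixes z :: "complex ^ 'n::{finite, linorder}"
  assumes "m > 0" "p dvd m" and z: "\<And>i. norm (z $ i) < 1"
  shows "theta m p z \<in> interior (Theta_closed m p)"
proof -
  define U :: "(complex ^ 'n::{finite, linorder}) set"
    where "U = {w. \<forall>b\<in>cball 0 1. char_form 1 b (power_last p w) \<noteq> 0}"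
  have "closed {(b, w :: complex ^ 'n::{finite, linorder}). char_form 1 b (power_last p w) = 0}"
    unfolding case_prod_unfold char_form_def
    by (intro closed_Collect_eq continuous_intros
        continuous_on_compose2[OF continuous_on_power_last[of UNIV]]) auto
  then have "closed {w. \<exists>b. b \<in> cball 0 1 \<and>
      (b, w) \<in> {(b, w :: complex ^ 'n::{finite, linorder}). char_form 1 b (power_last p w) = 0}}"
    by (intro closed_compact_projection compact_cball)
  then have "open U"
    unfolding U_def open_closed by (rule back_subst[of closed]) auto
  moreover have "U \<subseteq> Theta_closed m p"
  proof
    fix w assume w: "w \<in> U"
    obtain y where y: "theta m p y = w" using theta_surj[OF assms(1,2)] by blast
    have "norm (y $ k) \<le> 1" for k
    proof (rule ccontr)
      assume "\<not> norm (y $ k) \<le> 1"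
      then have "norm ((y $ k) ^ m) \<ge> 1" by (simp add: norm_power)
      then have nz: "(y $ k) ^ m \<noteq> 0" and "norm (inverse ((y $ k) ^ m)) \<le> 1"
        by (auto simp: norm_inverse inverse_le_1_iff simp del: power_eq_0_iff)
      \<comment> \<open>The number \<open>- 1 / (y $ k)\<^sup>m\<close> would be a zero of the reciprocal polynomial.\<close>
      then have "char_form 1 (- inverse ((y $ k) ^ m)) (power_last p w) \<noteq> 0"
        using w by (simp add: U_def)
      then have "1 + - inverse ((y $ k) ^ m) * (y $ k) ^ m \<noteq> 0"
        unfolding y[symmetric] char_form_theta[OF assms(2)] by (simp only: prod_zero_iff finite) blast
      then show False using nz by simp
    qed
    then show "w \<in> Theta_closed m p"
      unfolding Theta_closed_def y[symmetric] by (auto simp: closed_polydisc_def)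
  qed
  moreover have "theta m p z \<in> U"
  proof -
    have "1 + b * (z $ k) ^ m \<noteq> 0" if "norm b \<le> 1" for b k
    proof
      assume "1 + b * (z $ k) ^ m = 0"
      then have "b * (z $ k) ^ m = -1" by (simp add: add_eq_0_iff)
      then have "norm b * norm (z $ k) ^ m = 1"
        by (metis norm_minus_cancel norm_mult norm_one norm_power)
      moreover have "norm b * norm (z $ k) ^ m \<le> 1 * norm (z $ k) ^ m"
        by (intro mult_right_mono that) simp
      moreover have "norm (z $ k) ^ m < 1"
        using z assms(1) by (simp add: power_less_one_iff)
      ultimately show False by simp
    qed
    then show ?thesis by (simp add: U_def char_form_theta[OF assms(2)])
  qed
  ultimately show ?thesis by (meson interiorI)
qed

section \<open>The image of the torus is a boundary\<close>

lemma mholomorphic_on_compose_holomorphic: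
  assumes f: "mholomorphic_on f U" and "open S"
    and \<gamma>: "\<And>i. (\<lambda>t. \<gamma> t $ i) holomorphic_on S" and "\<gamma> ` S \<subseteq> U"
  shows "(\<lambda>t. f (\<gamma> t)) holomorphic_on S"
proof -
  have "(\<lambda>t. f (\<gamma> t)) field_differentiable (at t)" if "t \<in> S" for t
  proof -
    define d where "d = (\<chi> i. deriv (\<lambda>t. \<gamma> t $ i) t)"
    have comp: "((\<lambda>t. \<gamma> t $ i) has_derivative (\<lambda>h. h * d $ i)) (at t)" for i
      using holomorphic_derivI[OF \<gamma> \<open>open S\<close> that, of i]
      unfolding has_field_derivative_def d_def vec_lambda_beta
      by (rule back_subst[of "\<lambda>h. (_ has_derivative h) _"]) (rule ext, rule mult.commute)
    have \<gamma>': "(\<gamma> has_derivative (\<lambda>h. h *s d)) (at t)"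
      unfolding has_derivative_componentwise_within[of \<gamma>]
    proof
      fix e :: "complex ^ 'a" assume "e \<in> Basis"
      then obtain i b where e: "e = axis i b" by (auto simp: Basis_vec_def)
      show "((\<lambda>x. \<gamma> x \<bullet> e) has_derivative (\<lambda>h. (h *s d) \<bullet> e)) (at t)"
        unfolding e inner_axis vector_smult_component
        by (rule has_derivative_inner_left[OF comp])
    qed
    have "\<gamma> t \<in> U" using assms(4) that by (rule subsetD[OF _ imageI])
    then obtain f' where f': "(f has_derivative f') (at (\<gamma> t))" "\<forall>c h. f' (c *s h) = c * f' h"
      using f unfolding mholomorphic_on_def by (elim ballE exE conjE) auto
    have "((\<lambda>t. f (\<gamma> t)) has_derivative (\<lambda>h. f' (h *s d))) (at t)"
      by (rule has_derivative_compose[OF \<gamma>' f'(1)])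
    moreover have "(\<lambda>h. f' (h *s d)) = (*) (f' d)"
      using f'(2) by (simp add: fun_eq_iff mult.commute)
    ultimately have "((\<lambda>t. f (\<gamma> t)) has_field_derivative f' d) (at t)"
      by (simp add: has_field_derivative_def)
    then show ?thesis unfolding field_differentiable_def by (rule exI)
  qed
  then show ?thesis
    by (simp add: holomorphic_on_open[OF \<open>open S\<close>] field_differentiable_def)
qed

lemma theta_holomorphic:
  assumes "\<And>i. (\<lambda>t. \<gamma> t $ i) holomorphic_on S"
  shows "(\<lambda>t. theta m p (\<gamma> t) $ i) holomorphic_on S"
  unfolding theta_def elem_sym_def
  by (cases "pos i < CARD('a)") (auto intro!: holomorphic_intros assms)

text \<open>
  On the circle the numerator is \<open>t\<close> times the conjugate of the denominator.
\<close>

lemma disc_automorphism: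
  assumes a: "norm (a :: complex) < 1"
  defines "\<psi> \<equiv> \<lambda>t. (t + a) / (1 + cnj a * t)"
  shows "\<And>t. norm t \<le> 1 \<Longrightarrow> 1 + cnj a * t \<noteq> 0"
    and "\<And>t. norm t < 1 \<Longrightarrow> norm (\<psi> t) < 1"
    and "\<And>t. norm t = 1 \<Longrightarrow> norm (\<psi> t) = 1"
proof -
  show nz: "1 + cnj a * t \<noteq> 0" if "norm t \<le> 1" for t
  proof
    assume "1 + cnj a * t = 0"
    then have "cnj a * t = -1" by (simp add: add_eq_0_iff)
    then have "norm a * norm t = 1"
      by (metis complex_mod_cnj norm_minus_cancel norm_mult norm_one)
    moreover have "norm a * norm t \<le> norm a * 1"
      by (intro mult_left_mono that) simp
    ultimately show False using a by simp
  qed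
  show "norm (\<psi> t) < 1" if "norm t < 1" for t
    using Moebius_function_norm_lt_1[of "-a" t 0] a that
    by (simp add: \<psi>_def Moebius_function_simple)
  show "norm (\<psi> t) = 1" if "norm t = 1" for t
  proof -
    have "t * cnj t = 1" using that by (simp add: complex_norm_square[symmetric])
    then have "t + a = t * cnj (1 + cnj a * t)"
      by (simp add: algebra_simps)
    then have "norm (t + a) = norm (1 + cnj a * t)"
      by (metis complex_mod_cnj mult_1 norm_mult that)
    then show ?thesis using nz[of t] that by (simp add: \<psi>_def norm_divide)
  qed
qed

text \<open>
  A single analytic disc joins \<open>z\<close>, its centre, to the torus, which contains its rim. This avoids moving the
  variables to the circle one at a time, which would leave the interior, where \<open>f\<close> is
  holomorphic, after the first variable.
\<close>

lemma maximum_modulus_open_polydisc: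
  fixes z :: "complex ^ 'n::{finite, linorder}"
  assumes "m > 0" "p dvd m" and f: "f \<in> hol_algebra (Theta_closed m p)"
    and M: "\<And>u. u \<in> torus \<Longrightarrow> norm (f (theta m p u)) \<le> M"
    and z: "\<And>i. norm (z $ i) < 1"
  shows "norm (f (theta m p z)) \<le> M"
proof -
  define \<psi> :: "complex \<Rightarrow> complex ^ 'n::{finite, linorder}" where "\<psi> t = (\<chi> i. (t + z $ i) / (1 + cnj (z $ i) * t))" for t
  have inside: "norm (\<psi> t $ i) < 1" if "norm t < 1" for t i
    using disc_automorphism(2)[OF z that] by (simp add: \<psi>_def)
  have boundary: "\<psi> t \<in> torus" if "norm t = 1" for t
    using disc_automorphism(3)[OF z that] by (simp add: \<psi>_def torus_def)
  have image: "\<psi> t \<in> closed_polydisc" if "t \<in> cball 0 1" for t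
  proof (cases "norm t = 1")
    case True
    then show ?thesis using boundary torus_subset by blast
  next
    case False
    then show ?thesis using that inside[of t] by (auto simp: closed_polydisc_def intro: less_imp_le)
  qed
  have "continuous_on (cball 0 1) \<psi>"
    unfolding \<psi>_def by (intro continuous_intros) (use disc_automorphism(1)[OF z] in auto)
  then have "continuous_on (cball 0 1) (\<lambda>t. theta m p (\<psi> t))"
    by (rule continuous_on_compose2[OF continuous_on_theta[of UNIV]]) simp
  moreover have "continuous_on (Theta_closed m p) f"
    using f by (simp add: hol_algebra_def)
  ultimately have cont: "continuous_on (cball 0 1) (\<lambda>t. f (theta m p (\<psi> t)))"
    by (elim continuous_on_compose2) (use image in \<open>auto simp: Theta_closed_def\<close>)
  have \<psi>_hol: "(\<lambda>t. \<psi> t $ i) holomorphic_on ball 0 1" for i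
    unfolding \<psi>_def vec_lambda_beta
    by (intro holomorphic_intros) (use disc_automorphism(1)[OF z] in auto)
  have hol: "(\<lambda>t. f (theta m p (\<psi> t))) holomorphic_on ball 0 1"
  proof (rule mholomorphic_on_compose_holomorphic)
    show "mholomorphic_on f (interior (Theta_closed m p))"
      using f by (simp add: hol_algebra_def)
    show "(\<lambda>t. theta m p (\<psi> t) $ i) holomorphic_on ball 0 1" for i
      by (rule theta_holomorphic[OF \<psi>_hol])
    show "(\<lambda>t. theta m p (\<psi> t)) ` ball 0 1 \<subseteq> interior (Theta_closed m p)"
      by (intro image_subsetI theta_open_polydisc_interior[OF assms(1,2)] inside) simp
  qed simp
  have "norm (f (theta m p (\<psi> 0))) \<le> M"
  proof (rule maximum_modulus_frontier[where S = "cball 0 1" and f = "\<lambda>t. f (theta m p (\<psi> t))"])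
    show "norm (f (theta m p (\<psi> t))) \<le> M" if "t \<in> frontier (cball 0 1)" for t
      using that by (intro M boundary) (simp add: frontier_cball)
  qed (use cont hol in simp_all)
  moreover have "\<psi> 0 = z" by (simp add: \<psi>_def vec_eq_iff)
  ultimately show ?thesis by simp
qed

lemma closed_boundary_theta_torus:
  assumes "m > 0" "p dvd m"
  shows "closed_boundary (Theta_closed m p) (theta m p ` (torus :: (complex ^ 'n::{finite, linorder}) set))"
  unfolding closed_boundary_def
proof (intro conjI ballI)
  let ?T = "torus :: (complex ^ 'n::{finite, linorder}) set"
  have compact: "compact (theta m p ` ?T)"
    by (intro compact_continuous_image continuous_on_theta compact_torus)
  then show "closed (theta m p ` ?T)" by (rule compact_imp_closed)
  show sub: "theta m p ` ?T \<subseteq> Theta_closed m p"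
    unfolding Theta_closed_def using torus_subset by (rule image_mono)
  fix f assume f: "f \<in> hol_algebra (Theta_closed m p :: (complex ^ 'n::{finite, linorder}) set)"
  then have cont: "continuous_on (Theta_closed m p) f"
    by (simp add: hol_algebra_def)
  have "(\<chi> i. 1) \<in> ?T" by (simp add: torus_def)
  then have "theta m p ` ?T \<noteq> {}" by blast
  then obtain b where b: "b \<in> theta m p ` ?T" "\<And>w. w \<in> theta m p ` ?T \<Longrightarrow> norm (f w) \<le> norm (f b)"
    using continuous_attains_sup[OF compact, of "\<lambda>w. norm (f w)"]
      continuous_on_norm[OF continuous_on_subset[OF cont sub]] by blast
  have "norm (f w) \<le> norm (f b)" if w: "w \<in> Theta_closed m p" for w
  proof -
    obtain z where z: "z \<in> closed_polydisc" "w = theta m p z"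
      using w by (auto simp: Theta_closed_def)
    \<comment> \<open>Points on the boundary of the polydisc are approached radially from inside.\<close>
    define r :: "nat \<Rightarrow> real" where "r N = 1 - inverse (real (Suc N))" for N
    have r: "0 \<le> r N" "r N < 1" for N
      by (auto simp: r_def inverse_le_1_iff)
    have in_polydisc: "norm ((r N *\<^sub>R z) $ i) < 1" for N i
    proof -
      have "norm (z $ i) \<le> 1" using z(1) by (simp add: closed_polydisc_def)
      then have "r N * norm (z $ i) \<le> r N * 1" using r by (intro mult_left_mono)
      then show ?thesis using r[of N] by simp
    qed
    have "r \<longlonglongrightarrow> 1 - 0"
      unfolding r_def by (intro tendsto_intros LIMSEQ_inverse_real_of_nat)
    then have "(\<lambda>N. r N *\<^sub>R z) \<longlonglongrightarrow> 1 *\<^sub>R z"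
      by (intro tendsto_intros) simp
    moreover have "continuous_on closed_polydisc (\<lambda>z. norm (f (theta m p z)))"
      using cont by (intro continuous_on_norm continuous_on_compose2[OF cont continuous_on_theta])
        (auto simp: Theta_closed_def)
    moreover have "r N *\<^sub>R z \<in> closed_polydisc" for N
      using in_polydisc[of N] by (auto simp: closed_polydisc_def intro: less_imp_le)
    ultimately have "(\<lambda>N. norm (f (theta m p (r N *\<^sub>R z)))) \<longlonglongrightarrow> norm (f (theta m p z))"
      by (intro continuous_on_tendsto_compose[of closed_polydisc "\<lambda>z. norm (f (theta m p z))"])
         (use z in auto)
    moreover have "norm (f (theta m p (r N *\<^sub>R z))) \<le> norm (f b)" for N
      by (rule maximum_modulus_open_polydisc[OF assms f _ in_polydisc]) (use b in auto)
    ultimately show ?thesis unfolding z(2) by (intro LIMSEQ_le_const2) auto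
  qed
  then show "\<exists>b\<in>theta m p ` ?T. \<forall>w\<in>Theta_closed m p. norm (f w) \<le> norm (f b)"
    using b(1) by blast
qed

section \<open>Peak functions at roots of unity\<close>

lemma hol_algebra_const: "(\<lambda>w. c) \<in> hol_algebra K"
  unfolding hol_algebra_def mholomorphic_on_def by (auto intro!: exI[of _ "\<lambda>h. 0"])

lemma hol_algebra_coord: "(\<lambda>w. w $ i) \<in> hol_algebra K"
  unfolding hol_algebra_def mholomorphic_on_def
  by (auto intro!: continuous_intros exI[of _ "\<lambda>h. h $ i"]
      bounded_linear_imp_has_derivative bounded_linear_vec_nth)

lemma hol_algebra_add:
  assumes "f \<in> hol_algebra K" "g \<in> hol_algebra K"
  shows "(\<lambda>w. f w + g w) \<in> hol_algebra K"
proof -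
  have "\<exists>h'. ((\<lambda>w. f w + g w) has_derivative h') (at z) \<and> (\<forall>c h. h' (c *s h) = c * h' h)"
    if z: "z \<in> interior K" for z
  proof -
    obtain f' g' where "(f has_derivative f') (at z)" "\<And>c h. f' (c *s h) = c * f' h"
      and "(g has_derivative g') (at z)" "\<And>c h. g' (c *s h) = c * g' h"
      using assms z unfolding hol_algebra_def mholomorphic_on_def by blast
    then show ?thesis
      by (intro exI[of _ "\<lambda>h. f' h + g' h"]) (auto intro: has_derivative_add simp: distrib_left)
  qed
  then show ?thesis
    using assms unfolding hol_algebra_def mholomorphic_on_def by (auto intro: continuous_on_add)
qed

lemma hol_algebra_mult:
  assumes "f \<in> hol_algebra K" "g \<in> hol_algebra K"
  shows "(\<lambda>w. f w * g w) \<in> hol_algebra K"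
proof -
  have "\<exists>h'. ((\<lambda>w. f w * g w) has_derivative h') (at z) \<and> (\<forall>c h. h' (c *s h) = c * h' h)"
    if z: "z \<in> interior K" for z
  proof -
    obtain f' g' where "(f has_derivative f') (at z)" "\<And>c h. f' (c *s h) = c * f' h"
      and "(g has_derivative g') (at z)" "\<And>c h. g' (c *s h) = c * g' h"
      using assms z unfolding hol_algebra_def mholomorphic_on_def by blast
    then show ?thesis
      by (intro exI[of _ "\<lambda>h. f z * g' h + f' h * g z"])
         (auto intro: has_derivative_mult simp: algebra_simps)
  qed
  then show ?thesis
    using assms unfolding hol_algebra_def mholomorphic_on_def by (auto intro: continuous_on_mult)
qed

lemma hol_algebra_sum:
  assumes "\<And>i. i \<in> I \<Longrightarrow> f i \<in> hol_algebra K"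
  shows "(\<lambda>w. \<Sum>i\<in>I. f i w) \<in> hol_algebra K"
  using assms
  by (induction I rule: infinite_finite_induct) (simp_all add: hol_algebra_const hol_algebra_add)

lemma hol_algebra_prod:
  assumes "\<And>i. i \<in> I \<Longrightarrow> f i \<in> hol_algebra K"
  shows "(\<lambda>w. \<Prod>i\<in>I. f i w) \<in> hol_algebra K"
  using assms
  by (induction I rule: infinite_finite_induct) (simp_all add: hol_algebra_const hol_algebra_mult)

lemma hol_algebra_power:
  assumes "f \<in> hol_algebra K"
  shows "(\<lambda>w. f w ^ N) \<in> hol_algebra K"
  using assms by (induction N) (simp_all add: hol_algebra_const hol_algebra_mult)

lemma hol_algebra_char_form: "(\<lambda>w. char_form a b (power_last p w)) \<in> hol_algebra K"
proof -
  have "(\<lambda>w. esym_coeff j (power_last p w)) \<in> hol_algebra K" for j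
    by (cases "j = 0"; cases "pos (inv_into UNIV pos j :: 'a) < CARD('a)")
       (simp_all add: esym_coeff_def power_last_def hol_algebra_const hol_algebra_coord hol_algebra_power)
  then show ?thesis
    unfolding char_form_def by (intro hol_algebra_sum hol_algebra_mult hol_algebra_const)
qed

text \<open>
  Compare \<open>g\<^sup>N D\<close> on \<open>B\<close> with its value at \<open>w0\<close>, which has modulus \<open>\<bar>D(w0)\<bar>\<close> for every \<open>N\<close>. Only the
  points of \<open>B\<close> where \<open>\<bar>D\<bar> \<ge> \<bar>D(w0)\<bar>\<close> can compete. They form a compact set \<open>C\<close> which, if \<open>w0 \<notin> B\<close>, contains no
  point with \<open>\<bar>g\<bar> = 1\<close>, so that \<open>g\<^sup>N\<close> tends to \<open>0\<close> uniformly on \<open>C\<close>. The factor \<open>D\<close> allows \<open>g\<close> to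
  attain modulus \<open>1\<close> at other points as well.
\<close>

lemma peak_point_in_closed_boundary:
  assumes "compact K" "closed_boundary K B" "g \<in> hol_algebra K" "D \<in> hol_algebra K"
    and w0: "w0 \<in> K" "norm (g w0) = 1" "D w0 \<noteq> 0"
    and le1: "\<And>w. w \<in> K \<Longrightarrow> norm (g w) \<le> 1"
    and peak: "\<And>w. w \<in> K \<Longrightarrow> norm (g w) = 1 \<Longrightarrow> w \<noteq> w0 \<Longrightarrow> D w = 0"
  shows "w0 \<in> B"
proof (rule ccontr)
  assume "w0 \<notin> B"
  have B: "closed B" "B \<subseteq> K" using assms(2) by (auto simp: closed_boundary_def)
  then have "compact B" using compact_Int_closed[OF assms(1), of B] by (simp add: Int_absorb1)
  have cont: "continuous_on B g" "continuous_on B D"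
    using assms(3,4) B continuous_on_subset by (auto simp: hol_algebra_def)
  define C where "C = {b \<in> B. norm (D w0) \<le> norm (D b)}"
  have "closed C"
    unfolding C_def by (intro continuous_on_closed_Collect_le continuous_intros cont B)
  then have "compact C"
    using compact_Int_closed[OF \<open>compact B\<close>, of C] by (simp add: C_def Int_absorb1)
  have dom: "\<exists>b\<in>C. norm (D w0) \<le> norm (g b) ^ N * norm (D b)" for N
  proof -
    have "(\<lambda>w. g w ^ N * D w) \<in> hol_algebra K"
      using assms by (intro hol_algebra_mult hol_algebra_power)
    then have "\<exists>b\<in>B. \<forall>w\<in>K. norm (g w ^ N * D w) \<le> norm (g b ^ N * D b)"
      using assms(2) unfolding closed_boundary_def by (elim conjE) (drule bspec, assumption, simp)
    then obtain b where b: "b \<in> B" "norm (g w0 ^ N * D w0) \<le> norm (g b ^ N * D b)"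
      using w0(1) by blast
    then have *: "norm (D w0) \<le> norm (g b) ^ N * norm (D b)"
      using w0(2) by (simp add: norm_mult norm_power)
    also have "\<dots> \<le> 1 * norm (D b)"
      using le1[of b] b(1) B(2) by (intro mult_right_mono power_le_one) auto
    finally show ?thesis using * b(1) by (auto simp: C_def)
  qed
  then have "C \<noteq> {}" by blast
  moreover have "continuous_on C g" "continuous_on C D"
    by (rule continuous_on_subset[OF cont(1)] continuous_on_subset[OF cont(2)],
        simp add: C_def)+
  ultimately obtain c d where c: "c \<in> C" "\<And>b. b \<in> C \<Longrightarrow> norm (g b) \<le> norm (g c)"
    and d: "d \<in> C" "\<And>b. b \<in> C \<Longrightarrow> norm (D b) \<le> norm (D d)"
    using continuous_attains_sup[OF \<open>compact C\<close>, of "\<lambda>b. norm (g b)"]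
      continuous_attains_sup[OF \<open>compact C\<close>, of "\<lambda>b. norm (D b)"] continuous_on_norm by blast
  have "c \<in> B" "norm (D w0) \<le> norm (D c)" using c(1) by (auto simp: C_def)
  then have "c \<in> K" "c \<noteq> w0" "D c \<noteq> 0" using B(2) \<open>w0 \<notin> B\<close> w0(3) by auto
  then have "norm (g c) < 1" using peak le1 by (meson less_le)
  then have "(\<lambda>N. norm (g c) ^ N * norm (D d)) \<longlonglongrightarrow> 0 * norm (D d)"
    by (intro tendsto_intros LIMSEQ_power_zero) simp
  then have "\<forall>\<^sub>F N in sequentially. norm (g c) ^ N * norm (D d) < norm (D w0)"
    using w0(3) by (intro order_tendstoD) auto
  then obtain N where N: "norm (g c) ^ N * norm (D d) < norm (D w0)"
    by (auto simp: eventually_sequentially)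
  obtain b where b: "b \<in> C" "norm (D w0) \<le> norm (g b) ^ N * norm (D b)"
    using dom by blast
  note b(2)
  also have "norm (g b) ^ N * norm (D b) \<le> norm (g c) ^ N * norm (D d)"
    using c(2)[OF b(1)] d(2)[OF b(1)] by (intro mult_mono power_mono) auto
  finally show False using N by simp
qed

text \<open>
  For each point of \<open>F\<close> take a factor in one coordinate that tells this point from \<open>w0\<close>.
\<close>

lemma separating_function:
  assumes "finite F" "w0 \<notin> F"
  shows "\<exists>D \<in> hol_algebra K. D w0 \<noteq> 0 \<and> (\<forall>w\<in>F. D w = 0)"
proof -
  have "\<forall>w\<in>F. \<exists>i. w0 $ i \<noteq> w $ i"
    using assms(2) by (metis vec_eq_iff)
  then obtain i where i: "\<And>w. w \<in> F \<Longrightarrow> w0 $ i w \<noteq> w $ i w" by metis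
  let ?D = "\<lambda>u. \<Prod>w\<in>F. u $ i w + - w $ i w"
  have "?D \<in> hol_algebra K"
    by (intro hol_algebra_prod hol_algebra_add hol_algebra_coord hol_algebra_const)
  moreover have "?D w0 \<noteq> 0" using i assms(1) by (auto simp: add_eq_0_iff)
  moreover have "?D w = 0" if "w \<in> F" for w
    using assms(1) that by (intro prod_zero) auto
  ultimately show ?thesis by (intro bexI[of _ ?D]) auto
qed

lemma one_plus_power_extremal:
  fixes x :: complex
  assumes "norm x \<le> 1" "norm (1 + x ^ N) = 2"
  shows "x ^ N = 1"
proof -
  have "norm (x ^ N) \<le> 1" using assms(1) by (simp add: norm_power power_le_one)
  moreover have "norm (1 + x ^ N) \<le> norm (1 :: complex) + norm (x ^ N)" by (rule norm_triangle_ineq)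
  ultimately have n1: "norm (x ^ N) = 1" using assms(2) by simp
  then have "norm (1 + x ^ N) = norm (1 :: complex) + norm (x ^ N)" using assms(2) by simp
  then show ?thesis using n1 norm_triangle_eq[of 1 "x ^ N"] by simp
qed

text \<open>
  The product of the numbers \<open>(1 + (z\<^sub>k\<^sup>m)\<^sup>N) / 2\<close>, all of modulus at most \<open>1\<close>, has modulus \<open>1\<close> only
  if every \<open>z\<^sub>k\<close> is an \<open>mN\<close>-th root of unity. So the set \<open>F\<close> of possible maximum points is
  finite.
\<close>

lemma theta_roots_of_unity_in_closed_boundary:
  fixes \<zeta> :: "complex ^ 'n::{finite, linorder}"
  assumes "m > 0" "p dvd m" and B: "closed_boundary (Theta_closed m p) B"
    and N: "N > 0" and \<zeta>: "\<And>k. (\<zeta> $ k) ^ N = 1"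
  shows "theta m p \<zeta> \<in> B"
proof -
  let ?K = "Theta_closed m p :: (complex ^ 'n::{finite, linorder}) set"
  \<comment> \<open>Splitting \<open>X\<^sup>N + 1\<close> into linear factors makes the symmetric product a polynomial in the
    coordinates of \<open>theta m p z\<close>.\<close>
  define q :: "complex poly" where "q = monom 1 N + 1"
  have deg: "degree q = N"
    unfolding q_def using N by (subst degree_add_eq_left) (auto simp: degree_monom_eq)
  have lead: "lead_coeff q = 1"
    using N unfolding deg by (simp add: q_def)
  obtain root where root: "smult (lead_coeff q) (\<Prod>i<degree q. [:- root i, 1:]) = q"
    using complex_poly_decompose'[of q] .
  have factor: "(\<Prod>i<N. - root i + x) = 1 + x ^ N" for x
  proof -
    have "(\<Prod>i<N. - root i + x) = poly q x"
      by (subst root[symmetric]) (simp only: lead, simp add: deg poly_prod)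
    then show ?thesis by (simp add: q_def poly_monom)
  qed
  define g :: "complex ^ 'n::{finite, linorder} \<Rightarrow> complex"
    where "g w = (\<Prod>i<N. char_form (- root i) 1 (power_last p w)) / 2 ^ CARD('n)" for w
  have g_hol: "g \<in> hol_algebra ?K"
    unfolding g_def divide_inverse
    by (intro hol_algebra_mult hol_algebra_prod hol_algebra_char_form hol_algebra_const)
  have g_theta: "g (theta m p z) = (\<Prod>k\<in>UNIV. (1 + ((z $ k) ^ m) ^ N) / 2)" for z
  proof -
    have "(\<Prod>i<N. char_form (- root i) 1 (power_last p (theta m p z)))
        = (\<Prod>i<N. \<Prod>k\<in>UNIV. - root i + (z $ k) ^ m)"
      by (simp add: char_form_theta[OF assms(2)])
    also have "\<dots> = (\<Prod>k\<in>UNIV. 1 + ((z $ k) ^ m) ^ N)"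
      by (subst prod.swap) (simp only: factor)
    finally show ?thesis by (simp add: g_def prod_dividef)
  qed
  have factor_le: "norm ((1 + ((z $ k) ^ m) ^ N) / 2) \<le> 1" if "z \<in> closed_polydisc" for z :: "complex ^ 'n::{finite, linorder}" and k
  proof -
    have "norm (((z $ k) ^ m) ^ N) \<le> 1"
      using that by (simp add: norm_power power_le_one closed_polydisc_def)
    then show ?thesis
      using norm_triangle_ineq[of 1 "((z $ k) ^ m) ^ N"] by (simp add: norm_divide)
  qed
  define F where "F = theta m p ` {z :: complex ^ 'n::{finite, linorder}. \<forall>k. z $ k \<in> {u. u ^ (m * N) = 1}}"
  have "finite F"
  proof -
    have "finite {u :: complex. u ^ (m * N) = 1}"
      using assms(1) N by (intro finite_nth_roots) simp
    then have "finite (vec_lambda ` (UNIV \<rightarrow>\<^sub>E {u. u ^ (m * N) = 1}) :: (complex ^ 'n::{finite, linorder}) set)"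
      by (intro finite_imageI finite_PiE) auto
    moreover have "{z :: complex ^ 'n::{finite, linorder}. \<forall>k. z $ k \<in> {u. u ^ (m * N) = 1}}
        \<subseteq> vec_lambda ` (UNIV \<rightarrow>\<^sub>E {u. u ^ (m * N) = 1})"
    proof
      fix z :: "complex ^ 'n::{finite, linorder}"
      assume "z \<in> {z. \<forall>k. z $ k \<in> {u. u ^ (m * N) = 1}}"
      then have "vec_nth z \<in> UNIV \<rightarrow>\<^sub>E {u. u ^ (m * N) = 1}" by (auto simp: PiE_def)
      then show "z \<in> vec_lambda ` (UNIV \<rightarrow>\<^sub>E {u. u ^ (m * N) = 1})"
        by (rule image_eqI[rotated]) simp
    qed
    ultimately have "finite {z :: complex ^ 'n::{finite, linorder}. \<forall>k. z $ k \<in> {u. u ^ (m * N) = 1}}"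
      by (rule rev_finite_subset)
    then show ?thesis unfolding F_def by (rule finite_imageI)
  qed
  then obtain D where D: "D \<in> hol_algebra ?K" "D (theta m p \<zeta>) \<noteq> 0"
      "\<And>w. w \<in> F - {theta m p \<zeta>} \<Longrightarrow> D w = 0"
    using separating_function[of "F - {theta m p \<zeta>}" "theta m p \<zeta>" ?K] by blast
  have le1: "norm (g w) \<le> 1" if "w \<in> ?K" for w
    using that factor_le unfolding Theta_closed_def
    by (auto simp: g_theta prod_norm[symmetric] intro!: prod_le_1)
  have peak: "w \<in> F" if w: "w \<in> ?K" "norm (g w) = 1" for w
  proof -
    obtain z where z: "z \<in> closed_polydisc" "w = theta m p z"
      using w(1) by (auto simp: Theta_closed_def)
    have "(z $ k) ^ (m * N) = 1" for k
    proof -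
      let ?h = "\<lambda>k. norm ((1 + ((z $ k) ^ m) ^ N) / 2)"
      have "1 = (\<Prod>k\<in>UNIV. ?h k)"
        using w(2) by (simp only: z(2) g_theta prod_norm[symmetric])
      also have "\<dots> = ?h k * (\<Prod>k\<in>UNIV - {k}. ?h k)"
        by (rule prod.remove) auto
      also have "\<dots> \<le> ?h k * 1"
        using factor_le[OF z(1)] by (intro mult_left_mono prod_le_1) auto
      finally have "?h k = 1" using factor_le[OF z(1), of k] by (intro antisym) auto
      then have "norm (1 + ((z $ k) ^ m) ^ N) = 2" by (simp add: norm_divide)
      moreover have "norm ((z $ k) ^ m) \<le> 1"
        using z(1) by (simp add: norm_power power_le_one closed_polydisc_def)
      ultimately show ?thesis
        unfolding power_mult by (intro one_plus_power_extremal)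
    qed
    then show ?thesis unfolding F_def z(2) by auto
  qed
  have "norm (\<zeta> $ k) = 1" for k
    using power_eq_1_iff[OF \<zeta>[of k]] N by simp
  then have "\<zeta> \<in> closed_polydisc" by (simp add: closed_polydisc_def)
  then have "theta m p \<zeta> \<in> ?K" by (simp add: Theta_closed_def)
  moreover have "norm (g (theta m p \<zeta>)) = 1"
  proof -
    have "((\<zeta> $ k) ^ m) ^ N = 1" for k
      using \<zeta>[of k] by (metis power_commuting_commutes power_mult mult.commute power_one)
    then show ?thesis by (simp add: g_theta)
  qed
  ultimately show ?thesis
    using peak_point_in_closed_boundary[OF compact_Theta_closed B g_hol D(1)] D(2,3) le1 peak by blast
qed

text \<open>
  Round the argument of each coordinate, as a fraction of a full turn, down to a multiple of
  \<open>1 / (N + 1)\<close>. All coordinates then share the exponent \<open>N + 1\<close>.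
\<close>

lemma torus_limit_of_roots_of_unity:
  fixes z :: "complex ^ 'n"
  assumes "z \<in> torus"
  shows "\<exists>Z. Z \<longlonglongrightarrow> z \<and> (\<forall>N k. (Z N $ k) ^ Suc N = 1)"
proof -
  define q where "q k = Arg (z $ k) / (2 * pi)" for k
  define r where "r N k = of_int \<lfloor>real (Suc N) * q k\<rfloor> / real (Suc N)" for N k
  define Z :: "nat \<Rightarrow> complex ^ 'n" where "Z N = (\<chi> k. cis (2 * pi * r N k))" for N
  have z: "z $ k = cis (2 * pi * q k)" for k
  proof -
    have "norm (z $ k) = 1" using assms by (simp add: torus_def)
    then have "z $ k \<noteq> 0" "sgn (z $ k) = z $ k" by (auto simp: sgn_eq)
    then have "z $ k = cis (Arg (z $ k))" by (simp add: cis_Arg)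
    then show ?thesis by (simp add: q_def)
  qed
  have "(\<lambda>N. r N k) \<longlonglongrightarrow> q k" for k
  proof (rule tendsto_sandwich)
    have bounds: "q k - inverse (real (Suc N)) \<le> r N k" "r N k \<le> q k" for N
    proof -
      define M where "M = real (Suc N)"
      then have "M > 0" by simp
      then have "q k - inverse M = (M * q k - 1) / M" "q k = (M * q k) / M"
        by (auto simp: field_simps)
      moreover have "M * q k - 1 \<le> of_int \<lfloor>M * q k\<rfloor>" "of_int \<lfloor>M * q k\<rfloor> \<le> M * q k"
        by linarith+
      ultimately show "q k - inverse (real (Suc N)) \<le> r N k" "r N k \<le> q k"
        using \<open>M > 0\<close> unfolding r_def M_def[symmetric] by (metis divide_right_mono less_imp_le)+
    qed
    then show "\<forall>\<^sub>F N in sequentially. q k - inverse (real (Suc N)) \<le> r N k"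
      "\<forall>\<^sub>F N in sequentially. r N k \<le> q k" by auto
    have "(\<lambda>N. q k - inverse (real (Suc N))) \<longlonglongrightarrow> q k - 0"
      by (intro tendsto_intros LIMSEQ_inverse_real_of_nat)
    then show "(\<lambda>N. q k - inverse (real (Suc N))) \<longlonglongrightarrow> q k" by simp
  qed auto
  then have "(\<lambda>N. cis (2 * pi * r N k)) \<longlonglongrightarrow> z $ k" for k
    unfolding z by (intro tendsto_intros)
  then have "Z \<longlonglongrightarrow> z"
    unfolding Z_def by (intro vec_tendstoI) simp
  moreover have "(Z N $ k) ^ Suc N = 1" for N k
  proof -
    have "(Z N $ k) ^ Suc N = cis (real (Suc N) * (2 * pi * r N k))"
      unfolding Z_def vec_lambda_beta by (rule Complex.DeMoivre)
    also have "real (Suc N) * (2 * pi * r N k) = 2 * pi * of_int \<lfloor>real (Suc N) * q k\<rfloor>"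
      unfolding r_def by (simp del: of_nat_Suc)
    finally show ?thesis by (simp only: cis_multiple_2pi Ints_of_int)
  qed
  ultimately show ?thesis by blast
qed

section \<open>The Shilov boundary\<close>

lemma theta_torus_subset_closed_boundary:
  fixes B :: "(complex ^ 'n::{finite, linorder}) set"
  assumes "m > 0" "p dvd m" and B: "closed_boundary (Theta_closed m p) B"
  shows "theta m p ` torus \<subseteq> B"
proof
  fix w :: "complex ^ 'n::{finite, linorder}"
  assume "w \<in> theta m p ` torus"
  then obtain z where z: "z \<in> torus" "w = theta m p z" by blast
  then obtain Z where Z: "Z \<longlonglongrightarrow> z" "\<And>N k. (Z N $ k) ^ Suc N = 1"
    using torus_limit_of_roots_of_unity by blast
  have "theta m p (Z N) \<in> B" for N
    by (rule theta_roots_of_unity_in_closed_boundary[OF assms(1,2) B, of "Suc N"]) (simp, rule Z(2))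
  moreover have "(\<lambda>N. theta m p (Z N)) \<longlonglongrightarrow> w"
    unfolding z(2) by (rule continuous_on_tendsto_compose[OF continuous_on_theta[of UNIV] Z(1)]) auto
  moreover have "closed B" using B by (simp add: closed_boundary_def)
  ultimately show "w \<in> B" by (meson closed_sequentially)
qed

theorem shilov_boundary_Theta_closed:
  assumes "m > 0" "p dvd m"
  shows "shilov_boundary (Theta_closed m p) = theta m p ` torus"
  unfolding shilov_boundary_def
  by (rule Least_equality)
     (use closed_boundary_theta_torus theta_torus_subset_closed_boundary assms in blast)+

lemma sym_map_eq_theta: "sym_map z = theta 1 1 z"
  using power_last_theta[of 1 1 z] by (simp add: power_last_def vec_eq_iff cong: if_cong)

lemma Gamma_closed_eq_Theta_closed: "Gamma_closed = Theta_closed 1 1"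
  by (simp add: Gamma_closed_def Theta_closed_def sym_map_eq_theta)

lemma power_last_Theta_closed:
  assumes "p dvd m" "w \<in> Theta_closed m p"
  shows "power_last p w \<in> Gamma_closed"
proof -
  obtain z where z: "z \<in> closed_polydisc" "w = theta m p z"
    using assms(2) by (auto simp: Theta_closed_def)
  then have "(\<chi> k. (z $ k) ^ m) \<in> closed_polydisc"
    by (simp add: closed_polydisc_def norm_power power_le_one)
  then show ?thesis
    unfolding Gamma_closed_def z(2) power_last_theta[OF assms(1)] by (rule imageI)
qed

lemma power_last_shilov_boundary:
  assumes "m > 0" "p dvd m" "w \<in> shilov_boundary (Theta_closed m p)"
  shows "power_last p w \<in> shilov_boundary Gamma_closed"
proof -
  obtain z where z: "z \<in> torus" "w = theta m p z"
    using assms by (auto simp: shilov_boundary_Theta_closed)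
  then have "(\<chi> k. (z $ k) ^ m) \<in> torus"
    by (simp add: torus_def norm_power)
  moreover have "shilov_boundary Gamma_closed = sym_map ` torus"
    by (simp add: Gamma_closed_eq_Theta_closed sym_map_eq_theta shilov_boundary_Theta_closed)
  ultimately show ?thesis
    unfolding z(2) power_last_theta[OF assms(2)] by blast
qed

theorem proposition4p5:
  fixes m p :: nat and \<Theta> :: "complex \<Rightarrow> complex ^ 'n::{finite, linorder}"
  assumes "m > 0" and "p > 0" and "p dvd m" and "CARD('n) \<ge> 2"
    and "Theta_inner m p \<Theta>"
  shows "Gamma_inner (\<lambda>z. \<chi> i. if pos i < CARD('n) then \<Theta> z $ i else (\<Theta> z $ i) ^ p)"
proof -
  have hol: "\<And>i. (\<lambda>z. \<Theta> z $ i) holomorphic_on ball 0 1"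
    and image: "\<Theta> ` ball 0 1 \<subseteq> Theta_closed m p"
    and radial: "AE t in lebesgue_on {0..2 * pi}. \<exists>l\<in>shilov_boundary (Theta_closed m p).
      ((\<lambda>r. \<Theta> (of_real r * cis t)) \<longlongrightarrow> l) (at_left 1)"
    using assms(5) by (auto simp: Theta_inner_def inner_function_def)
  have "inner_function Gamma_closed (\<lambda>z. power_last p (\<Theta> z))"
    unfolding inner_function_def
  proof (intro conjI allI)
    show "(\<lambda>z. power_last p (\<Theta> z) $ i) holomorphic_on ball 0 1" for i
      unfolding power_last_def
      by (cases "pos i < CARD('n)") (auto intro!: holomorphic_intros hol)
    show "(\<lambda>z. power_last p (\<Theta> z)) ` ball 0 1 \<subseteq> Gamma_closed"
      using image power_last_Theta_closed[OF assms(3)] by blast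
    show "AE t in lebesgue_on {0..2 * pi}. \<exists>l\<in>shilov_boundary Gamma_closed.
      ((\<lambda>r. power_last p (\<Theta> (of_real r * cis t))) \<longlongrightarrow> l) (at_left 1)"
      using radial
    proof (rule eventually_mono)
      fix t
      assume "\<exists>l\<in>shilov_boundary (Theta_closed m p). ((\<lambda>r. \<Theta> (of_real r * cis t)) \<longlongrightarrow> l) (at_left 1)"
      then obtain l where l: "l \<in> shilov_boundary (Theta_closed m p)"
        "((\<lambda>r. \<Theta> (of_real r * cis t)) \<longlongrightarrow> l) (at_left 1)" by blast
      have "((\<lambda>r. power_last p (\<Theta> (of_real r * cis t))) \<longlongrightarrow> power_last p l) (at_left 1)"
        by (rule continuous_on_tendsto_compose[OF continuous_on_power_last[of UNIV] l(2)]) auto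
      then show "\<exists>l\<in>shilov_boundary Gamma_closed.
          ((\<lambda>r. power_last p (\<Theta> (of_real r * cis t))) \<longlongrightarrow> l) (at_left 1)"
        using power_last_shilov_boundary[OF assms(1,3) l(1)] by blast
    qed
  qed
  then show ?thesis by (simp add: Gamma_inner_def power_last_def)
qed

end
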